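(* For each energy level $l$ and deadline $t$, and all levels of additional battery utilization $BU_1>BU_2$, $$v^{BU_1}_{l,t}\le v^{BU_2}_{l,t}.$$ Thus $v^{BU}_{l,t}\le v^{0}_{l,t}$ for any $BU\ge 1$. Here $v^{BU}_{l,t}$ is the optimal value of the linear program $\mathcal P^{BU}_{l,t}$ defined in the context.
   Context: Time is slotted. User $k$ arrives at a charging station at time $t_k$; the horizon ends at $T$. A contract $(l,t_{\text{dead}},BU)$ consists of an energy amount $l\in\{1,\dots,L\}$, a deadline $t_{\text{dead}}\in\{t_k+1,\dots,T\}$ and a maximum additional battery utilization $BU\in\{0,1,\dots,BU_{max}\}$. $\mathcal K_0$ is the finite set of electric vehicles (EVs) already present; $i\in\mathcal K_0$ needs energy $N_i$ by deadline $w_i$ and has remaining additional utilization allowance $BU_i$. For the new user put $N_k=l$, $w_k=t_{\text{dead}}$, $BU_k=BU$. Given data: EV charging and discharging efficiencies $\eta_{i,c}\le 1$, $\eta_{i,dc}\le 1$; EV battery levels at time $t_k$, $\text{EV}^{i,\mathrm{ini}}$, and bounds $d_{i,\min},d_{i,\max}$; rate limits $R_{min},R_{max}$; harvested renewable energy $\bar E^t$; station storage capacity $B_{max}$, initial storage level $B^0$, and station charging and discharging efficiencies $\eta_{c,cs},\eta_{d,cs}$; unit prices $c_t$ (buying from the grid) and $g_t$ (selling to the grid) with $c_t\ge g_t$. Problem $\mathcal P^{BU}_{l,t_{\text{dead}}}$: minimize $\sum_{t=t_k}^{T-1}(c_tq_t-g_tx_t)$ over $q_t,x_t,e_t,s_t\ge0$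 and, for $i\in\mathcal K_0\cup\{k\}$, $r^+_{i,t},r^-_{i,t}\ge0$, with real $r_{i,t}$, $\text{EV}_{i,t}$, $B^t$, subject to, for all relevant $t$ and all $i\in\mathcal K_0\cup\{k\}$: (1) $\sum_{t=t_k}^{w_i-1}r_{i,t}\ge N_i$; (2) $r_{i,t}=r^+_{i,t}-r^-_{i,t}$ and $R_{min}\le r_{i,t}\le R_{max}$; (3) $r_{t,\text{charge}}=\sum_{i}r^+_{i,t}/\eta_{i,c}$ and $r_{t,\text{discharge}}=\sum_{i}\eta_{i,dc}r^-_{i,t}$, sums over $\mathcal K_0\cup\{k\}$; (4) $\text{EV}_{i,t+1}=\text{EV}_{i,t}+r^+_{i,t}-r^-_{i,t}$, $\text{EV}_{i,t_k}=\text{EV}^{i,\mathrm{ini}}$, $d_{i,\min}\le \text{EV}_{i,t}\le d_{i,\max}$; (5) $B^{t+1}=B^t+\bar E^t\eta_{c,cs}-e_t/\eta_{d,cs}+s_t\eta_{c,cs}$, $0\le B^{t+1}\le B_{max}$, with initial level $B^0$ and $B^T=B^0$; (6) $q_t-r_{t,\text{charge}}+r_{t,\text{discharge}}-x_t=s_t-e_t$; (7) $\sum_{t=t_k}^{w_i-1}(r^+_{i,t}+r^-_{i,t})-N_i\le BU_i$. An EV takes part only before its deadline. $v^{BU}_{l,t}$ is the optimal value of $\mathcal P^{BU}_{l,t}$, with $v^{BU}_{l,t}=\infty$ if the problem is infeasible. *)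

theory Defs
  imports Complex_Main "HOL-Library.Extended_Real"
begin

text \<open>
  Data of the charging problem seen by the user \<open>newcomer\<close> (the index \<open>k\<close>) arriving in slot
  \<open>arrival\<close> (\<open>t\<^sub>k\<close>); \<open>present\<close> is \<open>\<K>\<^sub>0\<close>. The fields \<open>demand\<close>, \<open>deadline\<close>, \<open>allowance\<close> are
  \<open>N\<close>, \<open>w\<close>, \<open>BU\<close>; their values at \<open>newcomer\<close> are set by the contract, see \<open>with_contract\<close>.
\<close>

record 'i charging_data =
  arrival :: nat
  horizon :: nat
  present :: "'i set"
  newcomer :: 'i
  demand :: "'i \<Rightarrow> real"
  deadline :: "'i \<Rightarrow> nat"
  allowance :: "'i \<Rightarrow> real"
  eta_c :: "'i \<Rightarrow> real"
  eta_dc :: "'i \<Rightarrow> real"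
  ev_init :: "'i \<Rightarrow> real"
  d_min :: "'i \<Rightarrow> real"
  d_max :: "'i \<Rightarrow> real"
  R_min :: real
  R_max :: real
  renewable :: "nat \<Rightarrow> real"
  B_max :: real
  B_init :: real
  eta_c_cs :: real
  eta_d_cs :: real
  buy_price :: "nat \<Rightarrow> real"
  sell_price :: "nat \<Rightarrow> real"

definition users :: "'i charging_data \<Rightarrow> 'i set" where
  "users D = insert (newcomer D) (present D)"

definition slots :: "'i charging_data \<Rightarrow> nat set" where
  "slots D = {arrival D..<horizon D}"

text \<open>An EV takes part only in the slots before its deadline.\<close>

definition user_slots :: "'i charging_data \<Rightarrow> 'i \<Rightarrow> nat set" where
  "user_slots D i = {arrival D..<deadline D i}"

definition active_users :: "'i charging_data \<Rightarrow> nat \<Rightarrow> 'i set" where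
  "active_users D t = {i \<in> users D. t < deadline D i}"

definition valid_data :: "'i charging_data \<Rightarrow> bool" where
  "valid_data D \<longleftrightarrow>
     finite (present D) \<and> newcomer D \<notin> present D \<and>
     (\<forall>i\<in>users D. eta_c D i \<le> 1 \<and> eta_dc D i \<le> 1) \<and>
     (\<forall>t\<in>slots D. sell_price D t \<le> buy_price D t)"

definition with_contract :: "'i charging_data \<Rightarrow> nat \<Rightarrow> nat \<Rightarrow> nat \<Rightarrow> 'i charging_data" where
  "with_contract D l t_dead BU =
     D\<lparr>demand := (demand D)(newcomer D := real l),
       deadline := (deadline D)(newcomer D := t_dead),
       allowance := (allowance D)(newcomer D := real BU)\<rparr>"

text \<open>
  The decision variables. Only the entries in the slots constrained below matter; all others
  are unconstrained and do not enter the cost.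
\<close>

record 'i plan =
  q_buy :: "nat \<Rightarrow> real"
  x_sell :: "nat \<Rightarrow> real"
  e_out :: "nat \<Rightarrow> real"
  s_in :: "nat \<Rightarrow> real"
  r_plus :: "'i \<Rightarrow> nat \<Rightarrow> real"
  r_minus :: "'i \<Rightarrow> nat \<Rightarrow> real"
  r_net :: "'i \<Rightarrow> nat \<Rightarrow> real"
  ev_level :: "'i \<Rightarrow> nat \<Rightarrow> real"
  B_level :: "nat \<Rightarrow> real"

definition r_charge :: "'i charging_data \<Rightarrow> 'i plan \<Rightarrow> nat \<Rightarrow> real" where
  "r_charge D p t = (\<Sum>i\<in>active_users D t. r_plus p i t / eta_c D i)"

definition r_discharge :: "'i charging_data \<Rightarrow> 'i plan \<Rightarrow> nat \<Rightarrow> real" where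
  "r_discharge D p t = (\<Sum>i\<in>active_users D t. eta_dc D i * r_minus p i t)"

definition user_feasible :: "'i charging_data \<Rightarrow> 'i plan \<Rightarrow> 'i \<Rightarrow> bool" where
  "user_feasible D p i \<longleftrightarrow>
     (\<Sum>t\<in>user_slots D i. r_net p i t) \<ge> demand D i \<and>
     (\<forall>t\<in>user_slots D i.
        r_plus p i t \<ge> 0 \<and> r_minus p i t \<ge> 0 \<and>
        r_net p i t = r_plus p i t - r_minus p i t \<and>
        R_min D \<le> r_net p i t \<and> r_net p i t \<le> R_max D \<and>
        ev_level p i (t + 1) = ev_level p i t + r_plus p i t - r_minus p i t) \<and>
     ev_level p i (arrival D) = ev_init D i \<and>
     (\<forall>t\<in>{arrival D..deadline D i}. d_min D i \<le> ev_level p i t \<and> ev_level p i t \<le> d_max D i) \<and>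
     (\<Sum>t\<in>user_slots D i. r_plus p i t + r_minus p i t) - demand D i \<le> allowance D i"

definition station_feasible :: "'i charging_data \<Rightarrow> 'i plan \<Rightarrow> bool" where
  "station_feasible D p \<longleftrightarrow>
     (\<forall>t\<in>slots D.
        q_buy p t \<ge> 0 \<and> x_sell p t \<ge> 0 \<and> e_out p t \<ge> 0 \<and> s_in p t \<ge> 0 \<and>
        B_level p (t + 1) =
          B_level p t + renewable D t * eta_c_cs D - e_out p t / eta_d_cs D + s_in p t * eta_c_cs D \<and>
        0 \<le> B_level p (t + 1) \<and> B_level p (t + 1) \<le> B_max D \<and>
        q_buy p t - r_charge D p t + r_discharge D p t - x_sell p t = s_in p t - e_out p t) \<and>
     B_level p (arrival D) = B_init D \<and> B_level p (horizon D) = B_init D"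

definition feasible :: "'i charging_data \<Rightarrow> 'i plan set" where
  "feasible D = {p. station_feasible D p \<and> (\<forall>i\<in>users D. user_feasible D p i)}"

definition cost :: "'i charging_data \<Rightarrow> 'i plan \<Rightarrow> real" where
  "cost D p = (\<Sum>t\<in>slots D. buy_price D t * q_buy p t - sell_price D t * x_sell p t)"

text \<open>In \<^typ>\<open>ereal\<close> the infimum of the empty set is \<open>\<infinity>\<close>, the value of an infeasible problem.\<close>

definition opt_value :: "'i charging_data \<Rightarrow> ereal" where
  "opt_value D = (INF p\<in>feasible D. ereal (cost D p))"

definition v_opt :: "'i charging_data \<Rightarrow> nat \<Rightarrow> nat \<Rightarrow> nat \<Rightarrow> ereal" where
  "v_opt D BU l t = opt_value (with_contract D l t BU)"

end

theory Submission
  imports Defs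
begin

text \<open>The number \<open>BU\<close> enters the linear program only as an upper bound, on the
  newcomer's additional battery utilization. Raising it enlarges the feasible set
  (\<open>feasible_with_contract_mono\<close>) and keeps the objective
  (\<open>cost_with_contract\<close>), and an infimum over a larger set is no larger.\<close>

lemma user_feasible_allowance_mono:
  assumes "user_feasible D p i" "allowance D i \<le> a i"
  shows "user_feasible (D\<lparr>allowance := a\<rparr>) p i"
\<comment> \<open>With \<open>D\<close> written out field by field, the updated record differs only
  in the final bound, which \<open>order_trans\<close> relaxes.\<close>
proof (cases D)
  case fields
  show ?thesis
    using assms unfolding user_feasible_def user_slots_def fields charging_data.simps
    by (meson order_trans)
qed

lemma user_feasible_with_contract_mono:
  assumes "BU \<le> BU'" "user_feasible (with_contract D l t BU) p i"
  shows "user_feasible (with_contract D l t BU') p i"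
proof -
  have "with_contract D l t BU' =
      (with_contract D l t BU)\<lparr>allowance := (allowance D)(newcomer D := real BU')\<rparr>"
    by (simp add: with_contract_def)
  \<comment> \<open>Equality for the EVs already present; \<open>BU \<le> BU'\<close> at the
    newcomer.\<close>
  moreover have "allowance (with_contract D l t BU) i \<le> ((allowance D)(newcomer D := real BU')) i"
    using assms(1) by (simp add: with_contract_def)
  ultimately show ?thesis
    using user_feasible_allowance_mono[OF assms(2)] by simp
qed

text \<open>The station constraints never read the allowance, so only the per-user constraints have
  to be compared.\<close>

lemma feasible_with_contract_mono:
  assumes "BU \<le> BU'"
  shows "feasible (with_contract D l t BU) \<subseteq> feasible (with_contract D l t BU')"
proof -
  have "station_feasible (with_contract D l t BU) = station_feasible (with_contract D l t BU')"
    by (simp add: fun_eq_iff station_feasible_def slots_def r_charge_def r_discharge_def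
        active_users_def users_def with_contract_def)
  moreover have "users (with_contract D l t BU) = users (with_contract D l t BU')"
    by (simp add: users_def with_contract_def)
  ultimately show ?thesis
    by (auto simp: feasible_def intro: user_feasible_with_contract_mono[OF assms])
qed

lemma cost_with_contract [simp]: "cost (with_contract D l t BU) = cost D"
  by (simp add: fun_eq_iff cost_def slots_def with_contract_def)

text \<open>Infeasibility needs no separate case, since the infimum over the empty set is
  \<infinity> in \<open>ereal\<close>.\<close>

lemma v_opt_antimono:
  assumes "BU \<le> BU'"
  shows "v_opt D BU' l t \<le> v_opt D BU l t"
  by (simp add: v_opt_def opt_value_def INF_superset_mono feasible_with_contract_mono[OF assms])

theorem lemma1:
  fixes D :: "'i charging_data" and L BU_max :: nat
  assumes "valid_data D"
  shows "\<forall>l\<in>{1..L}. \<forall>t\<in>{arrival D + 1..horizon D}.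
           (\<forall>BU1\<in>{0..BU_max}. \<forall>BU2\<in>{0..BU_max}. BU1 > BU2 \<longrightarrow> v_opt D BU1 l t \<le> v_opt D BU2 l t) \<and>
           (\<forall>BU\<in>{1..BU_max}. v_opt D BU l t \<le> v_opt D 0 l t)"
  by (simp add: v_opt_antimono)

end
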